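(* Let $\mathcal{H}$ be a real reproducing kernel Hilbert space on $\Omega$, let $\psi:\Omega\to\mathbb{R}$ be continuous, and let $K_1\subseteq K_2\subseteq\Omega$ be nonempty compact sets. Suppose $K_2$ is a topiaric index. Then the topiary of $K_1$ (with respect to $\psi$ over $\mathcal{H}$) minimizes $$\|\mu-\mathrm{topiary}(K_2)\|$$ over all distributions $\mu$ on $K_1$.
   Context: $\Omega$ is a Hausdorff topological space. A real reproducing kernel Hilbert space $\mathcal{H}$ on $\Omega$ is a real Hilbert space of functions $\Omega\to\mathbb{R}$ for which each point evaluation is a bounded functional; $k_x\in\mathcal{H}$ denotes the element with $f(x)=\langle f,k_x\rangle$ for all $f\in\mathcal{H}$. A distribution on a compact set $K\subseteq\Omega$ is a regular Borel probability measure $\mu$ on $K$. It is understood that for every such $\mu$ the functional $f\mapsto\int f\,d\mu$ on $\mathcal{H}$ is well defined and bounded; the element of $\mathcal{H}$ representing it, the embedded distribution, is also denoted $\mu$: $\int f\,d\mu=\langle f,\mu\rangle$. Norms of distributions are norms of their embeddings in $\mathcal{H}$, and $\mu(x)=\langle \mu,k_x\rangle$. For a nonempty compact $K$, the topiary of $K$, denoted $\mathrm{topiary}(K)$, is a distribution on $K$ maximizing $\mathfrak{O}(\mu)=\int\psi\,d\mu-\|\mu\|^2/2$ over all distributions on $K$ (it is understood to exist; it need not be unique as a measure, but its embedding in $\mathcal{H}$ is unique). The aesthetic margin of a distribution $\mu$ is $\iota_\mu(x)=\psi(x)-\mu(x)-\int(\psi(t)-\mu(t))\,d\mu(t)$.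 The topiaric index of $K$ is $\mathrm{Topiary}(K)=\{x\in K:\iota_{\mathrm{topiary}(K)}(x)=0\}$, and a set is called a topiaric index if it equals $\mathrm{Topiary}(\mathcal{K})$ for some nonempty compact $\mathcal{K}\subseteq\Omega$. *)

theory Defs
  imports "HOL-Probability.Probability_Measure"
begin

text \<open>
  The space \<open>\<Omega>\<close> is the whole type \<open>'a\<close>. A reproducing kernel Hilbert space on it is a real
  Hilbert space \<open>'h\<close> with an evaluation map \<open>val\<close>, where \<open>val f\<close> is \<open>f\<close> as a function on \<open>'a\<close>.
  Injectivity of \<open>val\<close> says that an element is determined by its function, so that \<open>'h\<close> is a
  space of functions with pointwise operations.
\<close>

definition rkhs :: "('h::{real_inner,banach} \<Rightarrow> 'a \<Rightarrow> real) \<Rightarrow> bool" where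
  "rkhs val \<longleftrightarrow> inj val \<and> (\<forall>x. bounded_linear (\<lambda>f. val f x))"

definition kernel :: "('h::{real_inner,banach} \<Rightarrow> 'a \<Rightarrow> real) \<Rightarrow> 'a \<Rightarrow> 'h" where
  "kernel val x = (THE k. \<forall>f. val f x = f \<bullet> k)"

text \<open>
  A distribution on \<open>K\<close> has \<open>K\<close> itself as its underlying space. Regularity is with respect to
  the subspace topology of \<open>K\<close>; compactness of a subset of \<open>K\<close> does not depend on the ambient
  space.
\<close>

definition distribution_on :: "'a::t2_space set \<Rightarrow> 'a measure \<Rightarrow> bool" where
  "distribution_on K \<mu> \<longleftrightarrow>
     prob_space \<mu> \<and> sets \<mu> = sets (restrict_space borel K) \<and>
     (\<forall>B\<in>sets \<mu>.
        emeasure \<mu> B = (SUP C\<in>{C. compact C \<and> C \<subseteq> B}. emeasure \<mu> C) \<and>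
        emeasure \<mu> B = (INF U\<in>{U. openin (top_of_set K) U \<and> B \<subseteq> U}. emeasure \<mu> U))"

text \<open>The standing assumption that integration against a distribution is well defined and bounded.\<close>

definition distributions_embed :: "('h::{real_inner,banach} \<Rightarrow> 'a::t2_space \<Rightarrow> real) \<Rightarrow> bool" where
  "distributions_embed val \<longleftrightarrow>
     (\<forall>K \<mu>. compact K \<and> distribution_on K \<mu> \<longrightarrow>
        (\<forall>f. integrable \<mu> (val f)) \<and> bounded_linear (\<lambda>f. \<integral>x. val f x \<partial>\<mu>))"

definition embedding :: "('h::{real_inner,banach} \<Rightarrow> 'a \<Rightarrow> real) \<Rightarrow> 'a measure \<Rightarrow> 'h" where
  "embedding val \<mu> = (THE m. \<forall>f. (\<integral>x. val f x \<partial>\<mu>) = f \<bullet> m)"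

definition objective ::
  "('h::{real_inner,banach} \<Rightarrow> 'a \<Rightarrow> real) \<Rightarrow> ('a \<Rightarrow> real) \<Rightarrow> 'a measure \<Rightarrow> real" where
  "objective val \<psi> \<mu> = (\<integral>x. \<psi> x \<partial>\<mu>) - (norm (embedding val \<mu>))\<^sup>2 / 2"

text \<open>
  Being a topiary is a relation because the maximizing measure need not be unique. Statements about
  the topiary of \<open>K\<close> are made for an arbitrary measure satisfying it, whose existence is thereby
  presupposed.
\<close>

definition is_topiary ::
  "('h::{real_inner,banach} \<Rightarrow> 'a::t2_space \<Rightarrow> real) \<Rightarrow> ('a \<Rightarrow> real) \<Rightarrow> 'a set \<Rightarrow> 'a measure \<Rightarrow> bool"
  where "is_topiary val \<psi> K \<tau> \<longleftrightarrow> is_arg_max (objective val \<psi>) (distribution_on K) \<tau>"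

definition aesthetic_margin ::
  "('h::{real_inner,banach} \<Rightarrow> 'a \<Rightarrow> real) \<Rightarrow> ('a \<Rightarrow> real) \<Rightarrow> 'a measure \<Rightarrow> 'a \<Rightarrow> real" where
  "aesthetic_margin val \<psi> \<mu> x =
     \<psi> x - embedding val \<mu> \<bullet> kernel val x - (\<integral>t. (\<psi> t - embedding val \<mu> \<bullet> kernel val t) \<partial>\<mu>)"

text \<open>
  The aesthetic margin of a topiary \<open>\<tau>\<close> of \<open>\<K>\<close> does not depend on the choice of \<open>\<tau>\<close>, since all
  topiaries of \<open>\<K>\<close> have the same embedding and the same objective, hence the same integral of \<open>\<psi>\<close>.
\<close>

definition topiaric_index ::
  "('h::{real_inner,banach} \<Rightarrow> 'a::t2_space \<Rightarrow> real) \<Rightarrow> ('a \<Rightarrow> real) \<Rightarrow> 'a set \<Rightarrow> bool" where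
  "topiaric_index val \<psi> S \<longleftrightarrow>
     (\<exists>\<K> \<tau>. compact \<K> \<and> \<K> \<noteq> {} \<and> is_topiary val \<psi> \<K> \<tau> \<and>
        S = {x\<in>\<K>. aesthetic_margin val \<psi> \<tau> x = 0})"

end

theory Submission
  imports Defs
begin

text \<open>
  Let \<open>K\<^sub>2\<close> be the topiaric index of \<open>\<K>\<close> with topiary \<open>\<tau>\<close>, embedded as \<open>m\<close>. On \<open>K\<^sub>2\<close> the margin of
  \<open>\<tau>\<close> vanishes, so \<open>\<psi> = m + c\<close> there, and completing the square turns the objective of a
  distribution \<open>\<mu>\<close> on a compact subset of \<open>K\<^sub>2\<close> into a constant minus \<open>\<parallel>\<mu> - m\<parallel>\<^sup>2 / 2\<close>: topiaries of such
  subsets are nearest to \<open>m\<close>. The margin of \<open>\<tau>\<close> vanishes \<open>\<tau>\<close>-almost everywhere by first-order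
  optimality, so \<open>\<tau>\<close> lives on \<open>K\<^sub>2\<close>; hence distance zero is attained on \<open>K\<^sub>2\<close> and
  \<open>m\<close> is also the embedding of every topiary of \<open>K\<^sub>2\<close>.
\<close>

section \<open>First-order conditions and representing vectors\<close>

text \<open>Near zero the linear term dominates the quadratic one, and both signs of
  \<open>t\<close> are allowed. This turns optimality along a line into a vanishing
  derivative.\<close>

lemma linear_le_quadratic_imp_zero:
  fixes a b :: real
  assumes "\<And>t. \<bar>t\<bar> \<le> 1 \<Longrightarrow> a * t \<le> b * t\<^sup>2"
  shows "a = 0"
proof (rule ccontr)
  assume "a \<noteq> 0"
  \<comment> \<open>\<open>D\<close> is large enough that \<open>a / D\<close> is an admissible
    \<open>t\<close>, and it exceeds \<open>b\<close>; the hypothesis at \<open>t = a / D\<close>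
    would force \<open>D \<le> b\<close>.\<close>
  define D where "D = \<bar>a\<bar> + \<bar>b\<bar> + 1"
  have D: "D > 0" "\<bar>a\<bar> \<le> D" "b < D"
    by (auto simp: D_def)
  have "a * (a / D) \<le> b * (a / D)\<^sup>2"
    using D by (intro assms) simp
  hence "a\<^sup>2 * D \<le> a\<^sup>2 * b"
    using D by (simp add: field_simps power2_eq_square)
  thus False
    using \<open>a \<noteq> 0\<close> D by (simp add: mult_le_cancel_left)
qed

text \<open>Riesz representation: the representing vector minimizes \<open>\<lambda>x. \<parallel>x\<parallel>\<^sup>2 / 2 - F x\<close>, and a minimizing
  sequence is Cauchy by the parallelogram law.\<close>

lemma riesz_representation:
  fixes F :: "'h::{real_inner,banach} \<Rightarrow> real"
  assumes "bounded_linear F"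
  shows "\<exists>m. \<forall>f. F f = f \<bullet> m"
proof -
  interpret F: bounded_linear F by fact
  define q where "q x = (norm x)\<^sup>2 / 2 - F x" for x
  obtain B where B: "\<And>x. norm (F x) \<le> norm x * B"
    using F.bounded by blast
  \<comment> \<open>Completing the square in \<open>norm x\<close> with the operator bound
    \<open>B\<close> bounds \<open>q\<close> from below.\<close>
  have "- (B\<^sup>2) / 2 \<le> q x" for x
  proof -
    have "F x \<le> norm x * B" using B[of x] by simp
    moreover have "0 \<le> (norm x - B)\<^sup>2" by simp
    ultimately show ?thesis
      by (simp add: q_def power2_diff)
  qed
  hence bdd: "bdd_below (range q)" by (intro bdd_belowI2)
  define I where "I = (INF x. q x)"
  have I_le: "I \<le> q x" for x
    unfolding I_def by (intro cINF_lower bdd) auto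
  have "\<exists>x. q x < I + inverse (real (Suc n))" for n
    using cINF_less_iff[OF _ bdd, of "I + inverse (real (Suc n))"] by (auto simp: I_def)
  then obtain X where X: "\<And>n. q (X n) < I + inverse (real (Suc n))" by metis
  \<comment> \<open>The parallelogram law in terms of \<open>q\<close>: the linear part
    \<open>F\<close> cancels at the midpoint.\<close>
  have par: "(norm (x - y))\<^sup>2 = 4 * (q x + q y - 2 * q ((1/2) *\<^sub>R (x + y)))" for x y
    unfolding q_def power2_norm_eq_inner
    by (simp add: F.scaleR F.add inner_add inner_diff inner_commute algebra_simps)
  \<comment> \<open>The midpoint value is at least \<open>I\<close>, while both endpoint values are
    below \<open>I + 1/(N+1)\<close>; the factor 8 is 4 times the two excesses.\<close>
  have close: "(norm (X m - X n))\<^sup>2 < 8 * inverse (real (Suc N))" if "m \<ge> N" "n \<ge> N" for m n N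
  proof -
    have X': "q (X k) < I + inverse (real (Suc N))" if "k \<ge> N" for k
      using X[of k] le_imp_inverse_le[of "real (Suc N)" "real (Suc k)"] that by linarith
    show ?thesis
      using X'[OF that(1)] X'[OF that(2)] I_le[of "(1/2) *\<^sub>R (X m + X n)"]
      unfolding par by argo
  qed
  have "Cauchy X"
  proof (rule CauchyI)
    fix e :: real assume "e > 0"
    then obtain N where "inverse (real (Suc N)) < e\<^sup>2 / 8"
      using reals_Archimedean[of "e\<^sup>2 / 8"] by auto
    hence "(norm (X m - X n))\<^sup>2 < e\<^sup>2" if "m \<ge> N" "n \<ge> N" for m n
      using close[OF that] by simp
    thus "\<exists>N. \<forall>m\<ge>N. \<forall>n\<ge>N. norm (X m - X n) < e"
      using \<open>e > 0\<close> by (meson less_imp_le power2_less_imp_less)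
  qed
  then obtain m where m: "X \<longlonglongrightarrow> m"
    using Cauchy_convergent convergent_def by blast
  have "(\<lambda>n. q (X n)) \<longlonglongrightarrow> q m"
    unfolding q_def by (intro tendsto_intros F.tendsto m) simp
  moreover have "(\<lambda>n. I + inverse (real (Suc n))) \<longlonglongrightarrow> I + 0"
    by (intro tendsto_intros LIMSEQ_inverse_real_of_nat)
  moreover have "\<exists>N. \<forall>n\<ge>N. q (X n) \<le> I + inverse (real (Suc n))"
    using X less_imp_le by blast
  ultimately have "q m \<le> I + 0" by (rule LIMSEQ_le)
  hence q_min: "q m \<le> q x" for x
    using I_le[of x] by linarith
  \<comment> \<open>The variation of the minimizer \<open>m\<close> in direction \<open>f\<close>
    has derivative \<open>f \<bullet> m - F f\<close> at zero.\<close>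
  have "F f - f \<bullet> m = 0" for f
  proof (rule linear_le_quadratic_imp_zero)
    fix t :: real
    show "(F f - f \<bullet> m) * t \<le> (norm f)\<^sup>2 / 2 * t\<^sup>2"
      using q_min[of "m + t *\<^sub>R f"] unfolding q_def power2_norm_eq_inner
      by (simp add: F.add F.scaleR inner_add inner_commute algebra_simps power2_eq_square)
  qed
  thus ?thesis by (intro exI[of _ m]) simp
qed

text \<open>Riesz supplies a representing vector, and vectors with equal inner products against
  everything coincide, so the definite description denotes it.\<close>

lemma inner_kernel:
  assumes "rkhs val"
  shows "f \<bullet> kernel val x = val f x"
proof -
  have "bounded_linear (\<lambda>f. val f x)"
    using assms by (simp add: rkhs_def)
  from riesz_representation[OF this] obtain k where k: "\<forall>f. val f x = f \<bullet> k" ..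
  hence "kernel val x = k"
    unfolding kernel_def
    by (intro the_equality) (auto intro: vector_eq_ldot[THEN iffD1])
  with k show ?thesis by simp
qed

lemma embedding_eqI:
  assumes "\<And>f. (\<integral>x. val f x \<partial>\<mu>) = f \<bullet> m"
  shows "embedding val \<mu> = m"
  unfolding embedding_def using assms
  by (intro the_equality) (auto intro: vector_eq_ldot[THEN iffD1])

lemma inner_embedding:
  assumes "distributions_embed val" "compact K" "distribution_on K \<mu>"
  shows "f \<bullet> embedding val \<mu> = (\<integral>x. val f x \<partial>\<mu>)"
proof -
  have "bounded_linear (\<lambda>f. \<integral>x. val f x \<partial>\<mu>)"
    using assms unfolding distributions_embed_def by blast
  from riesz_representation[OF this] obtain m where m: "\<forall>f. (\<integral>x. val f x \<partial>\<mu>) = f \<bullet> m" ..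
  with embedding_eqI[of \<mu> val m] show ?thesis by simp
qed

section \<open>Measurability, integrability and regularity of distributions\<close>

lemma space_distribution_on: "distribution_on K \<mu> \<Longrightarrow> space \<mu> = K"
  unfolding distribution_on_def by (metis Int_UNIV_right sets_eq_imp_space_eq space_borel space_restrict_space)

lemma compact_in_sets_distribution_on:
  assumes "distribution_on K \<mu>" "compact C" "C \<subseteq> K"
  shows "C \<in> sets \<mu>"
  using assms unfolding distribution_on_def
  by (auto simp: sets_restrict_space intro!: rev_image_eqI[of C] borel_closed compact_imp_closed)

lemma openin_in_sets_distribution_on:
  assumes "distribution_on K \<mu>" "openin (top_of_set K) U"
  shows "U \<in> sets \<mu>"
  using assms unfolding distribution_on_def
  by (auto simp: sets_restrict_space openin_open intro!: imageI borel_open)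

lemma integrable_distribution_on:
  assumes "distribution_on K \<mu>" "compact K" "continuous_on K (\<psi> :: _ \<Rightarrow> real)"
  shows "integrable \<mu> \<psi>"
proof -
  interpret prob_space \<mu> using assms(1) by (simp add: distribution_on_def)
  obtain B where "\<And>x. x \<in> K \<Longrightarrow> norm (\<psi> x) \<le> B"
    using compact_continuous_image[OF assms(3,2)] compact_imp_bounded
    by (metis bounded_iff imageI)
  moreover have "\<psi> \<in> borel_measurable \<mu>"
    using borel_measurable_continuous_on_restrict[OF assms(3)] assms(1)
    by (metis distribution_on_def measurable_cong_sets)
  ultimately show ?thesis
    using space_distribution_on[OF assms(1)] by (intro integrable_const_bound[of _ B]) auto
qed

text \<open>Regularity passes to \<open>\<nu>\<close> because a compact or open set approximating
  \<open>B\<close> within \<open>e / c\<close> for \<open>\<mu>\<close> approximates it within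
  \<open>e\<close> for \<open>\<nu>\<close>: the error is the measure of a difference set, to which
  the domination applies.\<close>

lemma distribution_on_dominated:
  assumes \<mu>: "distribution_on K \<mu>" and \<nu>: "prob_space \<nu>" and sets: "sets \<nu> = sets \<mu>"
    and le: "\<And>B. B \<in> sets \<mu> \<Longrightarrow> measure \<nu> B \<le> c * measure \<mu> B" and c: "c > 0"
  shows "distribution_on K \<nu>"
proof -
  interpret \<mu>: prob_space \<mu> using \<mu> by (simp add: distribution_on_def)
  interpret \<nu>: prob_space \<nu> by fact
  \<comment> \<open>One estimate for both kinds of regularity: \<open>B\<close> plays the compact
    set inside \<open>A\<close>, or \<open>A\<close> the open set around \<open>B\<close>.\<close>
  have close: "measure \<nu> A \<le> measure \<nu> B + e"
    if "A \<in> sets \<mu>" "B \<in> sets \<mu>" "B \<subseteq> A" "emeasure \<mu> A \<le> emeasure \<mu> B + ennreal (e / c)" "e > 0"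
    for A B e
  proof -
    have "measure \<mu> A \<le> measure \<mu> B + e / c"
      using that c by (simp add: \<mu>.emeasure_eq_measure flip: ennreal_plus)
    hence "measure \<mu> (A - B) \<le> e / c"
      using that by (simp add: \<mu>.finite_measure_Diff)
    hence "c * measure \<mu> (A - B) \<le> e"
      using c by (simp add: field_simps)
    with le[of "A - B"] have "measure \<nu> (A - B) \<le> e" using that by auto
    thus ?thesis using that sets by (simp add: \<nu>.finite_measure_Diff)
  qed
  have "emeasure \<nu> B = (SUP C\<in>{C. compact C \<and> C \<subseteq> B}. emeasure \<nu> C)"
    "emeasure \<nu> B = (INF U\<in>{U. openin (top_of_set K) U \<and> B \<subseteq> U}. emeasure \<nu> U)"
    if B: "B \<in> sets \<mu>" for B
  proof -
    have BK: "B \<subseteq> K"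
      using sets.sets_into_space[OF B] space_distribution_on[OF \<mu>] by simp
    have inner: "emeasure \<mu> B = (SUP C\<in>{C. compact C \<and> C \<subseteq> B}. emeasure \<mu> C)"
      and outer: "emeasure \<mu> B = (INF U\<in>{U. openin (top_of_set K) U \<and> B \<subseteq> U}. emeasure \<mu> U)"
      using \<mu> B unfolding distribution_on_def by blast+
    show "emeasure \<nu> B = (SUP C\<in>{C. compact C \<and> C \<subseteq> B}. emeasure \<nu> C)"
    proof (rule ennreal_approx_SUP)
      fix e :: real assume e: "e > 0"
      have "\<exists>C\<in>{C. compact C \<and> C \<subseteq> B}. emeasure \<mu> B < emeasure \<mu> C + ennreal (e / c)"
        using e c by (intro SUP_approx_ennreal[OF _ _ inner]) (auto intro: exI[of _ "{}"])
      then obtain C where C: "compact C" "C \<subseteq> B" "emeasure \<mu> B \<le> emeasure \<mu> C + ennreal (e / c)"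
        by (auto intro: less_imp_le)
      have "C \<in> sets \<mu>"
        using compact_in_sets_distribution_on[OF \<mu> C(1)] C(2) BK by blast
      hence "measure \<nu> B \<le> measure \<nu> C + e"
        using close B C e by blast
      thus "\<exists>C\<in>{C. compact C \<and> C \<subseteq> B}. emeasure \<nu> B \<le> emeasure \<nu> C + ennreal e"
        using C e by (auto simp: \<nu>.emeasure_eq_measure simp flip: ennreal_plus)
    qed (auto intro!: emeasure_mono simp: B sets)
    show "emeasure \<nu> B = (INF U\<in>{U. openin (top_of_set K) U \<and> B \<subseteq> U}. emeasure \<nu> U)"
    proof (rule ennreal_approx_INF)
      fix e :: real assume e: "e > 0"
      have "\<exists>U\<in>{U. openin (top_of_set K) U \<and> B \<subseteq> U}. emeasure \<mu> U < emeasure \<mu> B + ennreal (e / c)"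
        using e c BK by (intro INF_approx_ennreal[OF _ outer]) auto
      then obtain U where U: "openin (top_of_set K) U" "B \<subseteq> U"
          "emeasure \<mu> U \<le> emeasure \<mu> B + ennreal (e / c)"
        by (auto intro: less_imp_le)
      have "U \<in> sets \<mu>"
        using openin_in_sets_distribution_on[OF \<mu> U(1)] .
      hence "measure \<nu> U \<le> measure \<nu> B + e"
        using close B U e by blast
      thus "\<exists>U\<in>{U. openin (top_of_set K) U \<and> B \<subseteq> U}. emeasure \<nu> U \<le> emeasure \<nu> B + ennreal e"
        using U e by (auto simp: \<nu>.emeasure_eq_measure simp flip: ennreal_plus)
    qed (auto intro!: emeasure_mono simp: sets openin_in_sets_distribution_on[OF \<mu>])
  qed
  thus ?thesis
    using \<mu> \<nu> sets unfolding distribution_on_def by auto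
qed

text \<open>Full measure of \<open>S\<close> keeps the total mass at 1. Inner regularity involves
  the same compact sets as before; outer regularity has to be moved to the subspace topology of
  \<open>S\<close>.\<close>

lemma distribution_on_restrict_space:
  assumes \<mu>: "distribution_on K \<mu>" and "compact S" "S \<subseteq> K" and full: "AE x in \<mu>. x \<in> S"
  shows "distribution_on S (restrict_space \<mu> S)"
proof -
  interpret prob_space \<mu> using \<mu> by (simp add: distribution_on_def)
  have S: "S \<in> sets \<mu>"
    using compact_in_sets_distribution_on assms by blast
  hence S': "S \<inter> space \<mu> \<in> sets \<mu>" by auto
  have em: "emeasure (restrict_space \<mu> S) B = emeasure \<mu> B" if "B \<subseteq> S" for B
    using emeasure_restrict_space[OF S' that] .
  have sets_S: "B \<in> sets \<mu>" if "B \<in> sets (restrict_space \<mu> S)" for B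
    using that S' by (simp add: sets_restrict_space_iff)
  have "prob_space (restrict_space \<mu> S)"
    using S full em[of S] emeasure_eq_1_AE[OF S]
    by (intro prob_spaceI) (simp add: space_restrict_space Int_absorb2 sets.sets_into_space)
  moreover have "sets (restrict_space \<mu> S) = sets (restrict_space borel S)"
    using \<mu> \<open>S \<subseteq> K\<close> unfolding distribution_on_def
    by (simp add: sets_restrict_space image_image Int_absorb2 flip: Int_assoc)
  moreover have "emeasure (restrict_space \<mu> S) B =
        (SUP C\<in>{C. compact C \<and> C \<subseteq> B}. emeasure (restrict_space \<mu> S) C)"
      "emeasure (restrict_space \<mu> S) B =
        (INF U\<in>{U. openin (top_of_set S) U \<and> B \<subseteq> U}. emeasure (restrict_space \<mu> S) U)"
    if B: "B \<in> sets (restrict_space \<mu> S)" for B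
  proof -
    have BS: "B \<subseteq> S"
      using sets.sets_into_space[OF B] by (simp add: space_restrict_space)
    have inner: "emeasure \<mu> B = (SUP C\<in>{C. compact C \<and> C \<subseteq> B}. emeasure \<mu> C)"
      and outer: "emeasure \<mu> B = (INF U\<in>{U. openin (top_of_set K) U \<and> B \<subseteq> U}. emeasure \<mu> U)"
      using \<mu> sets_S[OF B] unfolding distribution_on_def by blast+
    show "emeasure (restrict_space \<mu> S) B =
        (SUP C\<in>{C. compact C \<and> C \<subseteq> B}. emeasure (restrict_space \<mu> S) C)"
      using inner BS by (auto simp: em intro!: SUP_cong)
    show "emeasure (restrict_space \<mu> S) B =
        (INF U\<in>{U. openin (top_of_set S) U \<and> B \<subseteq> U}. emeasure (restrict_space \<mu> S) U)"
    proof (rule antisym)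
      show "emeasure (restrict_space \<mu> S) B \<le>
          (INF U\<in>{U. openin (top_of_set S) U \<and> B \<subseteq> U}. emeasure (restrict_space \<mu> S) U)"
      proof (rule INF_greatest, clarify)
        fix U assume U: "openin (top_of_set S) U" "B \<subseteq> U"
        have "U \<in> sets (restrict_space \<mu> S)"
          using U \<open>S \<subseteq> K\<close> S' \<mu> unfolding distribution_on_def
          by (auto simp: sets_restrict_space_iff openin_open sets_restrict_space intro: S borel_open)
        thus "emeasure (restrict_space \<mu> S) B \<le> emeasure (restrict_space \<mu> S) U"
          using U by (intro emeasure_mono)
      qed
      show "(INF U\<in>{U. openin (top_of_set S) U \<and> B \<subseteq> U}. emeasure (restrict_space \<mu> S) U)
          \<le> emeasure (restrict_space \<mu> S) B"
        unfolding em[OF BS] outer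
      proof (rule INF_mono, clarify)
        fix U assume U: "openin (top_of_set K) U" "B \<subseteq> U"
        \<comment> \<open>The trace on \<open>S\<close> of a competitor for \<open>K\<close> still
          covers \<open>B\<close> and has no larger measure.\<close>
        have "openin (top_of_set S) (S \<inter> U)"
          using U(1) \<open>S \<subseteq> K\<close> by (auto simp: openin_open)
        moreover have "emeasure (restrict_space \<mu> S) (S \<inter> U) \<le> emeasure \<mu> U"
          unfolding em[OF Int_lower1]
          by (intro emeasure_mono openin_in_sets_distribution_on[OF \<mu> U(1)]) auto
        ultimately show "\<exists>V\<in>{U. openin (top_of_set S) U \<and> B \<subseteq> U}.
            emeasure (restrict_space \<mu> S) V \<le> emeasure \<mu> U"
          using U BS by (intro bexI[of _ "S \<inter> U"]) auto
      qed
    qed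
  qed
  ultimately show ?thesis
    unfolding distribution_on_def by blast
qed

section \<open>Perturbing a distribution, and stationarity at a topiary\<close>

text \<open>The density has mean 1 and, as \<open>\<bar>t\<bar> \<le> 1\<close>, takes values
  between 0 and 2, so the tilted measure is a probability dominated by \<open>2 * \<mu>\<close>.
  Integrals become affine in \<open>t\<close>, with slope the covariance of \<open>h\<close> and the
  indicator of \<open>A\<close>.\<close>

lemma
  fixes \<mu> :: "'a::t2_space measure"
  assumes \<mu>: "distribution_on K \<mu>" and A[measurable]: "A \<in> sets \<mu>" and t: "\<bar>t\<bar> \<le> 1"
  defines "\<nu> \<equiv> density \<mu> (\<lambda>x. ennreal (1 + t * (indicator A x - measure \<mu> A)))"
  shows distribution_on_tilt: "distribution_on K \<nu>"
    and integral_tilt: "integrable \<mu> h \<Longrightarrow>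
      (\<integral>x. h x \<partial>\<nu>) = (\<integral>x. h x \<partial>\<mu>) + t * ((LINT x:A|\<mu>. h x) - measure \<mu> A * (\<integral>x. h x \<partial>\<mu>))"
proof -
  interpret prob_space \<mu> using \<mu> by (simp add: distribution_on_def)
  define g where "g x = 1 + t * (indicator A x - measure \<mu> A)" for x
  have "\<bar>t * (indicator A x - measure \<mu> A)\<bar> \<le> 1" for x
    unfolding abs_mult using t prob_le_1[of A]
    by (intro mult_le_one) (auto simp: indicator_def)
  hence g: "0 \<le> g x" "g x \<le> 2" for x
    unfolding g_def by (smt (verit))+
  have [measurable]: "g \<in> borel_measurable \<mu>" unfolding g_def by measurable
  have \<nu>: "\<nu> = density \<mu> g" unfolding \<nu>_def g_def ..
  have int: "(\<integral>x. h x \<partial>\<nu>) = (\<integral>x. h x \<partial>\<mu>) + t * ((LINT x:A|\<mu>. h x) - measure \<mu> A * (\<integral>x. h x \<partial>\<mu>))"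
    if h: "integrable \<mu> h" for h :: "'a \<Rightarrow> real"
  proof -
    have [measurable]: "h \<in> borel_measurable \<mu>" using h by simp
    have A_int: "integrable \<mu> (\<lambda>x. indicator A x * h x)"
      using integrable_mult_indicator[OF A h] by simp
    have "(\<integral>x. h x \<partial>\<nu>) = (\<integral>x. g x * h x \<partial>\<mu>)"
      unfolding \<nu> by (subst integral_density) (auto simp: g)
    also have "\<dots> = (\<integral>x. h x + t * (indicator A x * h x - measure \<mu> A * h x) \<partial>\<mu>)"
      by (simp add: g_def algebra_simps)
    also have "\<dots> = (\<integral>x. h x \<partial>\<mu>) + t * ((LINT x:A|\<mu>. h x) - measure \<mu> A * (\<integral>x. h x \<partial>\<mu>))"
      using h A_int by (simp add: set_lebesgue_integral_def)
    finally show ?thesis .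
  qed
  show "integrable \<mu> h \<Longrightarrow>
      (\<integral>x. h x \<partial>\<nu>) = (\<integral>x. h x \<partial>\<mu>) + t * ((LINT x:A|\<mu>. h x) - measure \<mu> A * (\<integral>x. h x \<partial>\<mu>))"
    by (rule int)
  have "prob_space \<nu>"
  proof (rule prob_spaceI)
    have "integrable \<mu> g"
      using g by (intro integrable_const_bound[of _ 2]) auto
    moreover have "(\<integral>x. g x \<partial>\<mu>) = 1"
    proof -
      \<comment> \<open>The centred indicator integrates to zero, so tilting preserves the total
        mass.\<close>
      have ind: "integrable \<mu> (\<lambda>x. indicator A x - prob A :: real)"
        by (intro Bochner_Integration.integrable_diff integrable_real_indicator A)
          (auto simp: less_top[symmetric])
      have "(\<integral>x. indicator A x - prob A \<partial>\<mu>) = 0"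
        by (subst Bochner_Integration.integral_diff) (use ind A in \<open>auto simp: prob_space less_top[symmetric]\<close>)
      thus ?thesis
        unfolding g_def using ind by (simp add: prob_space del: Bochner_Integration.integral_diff)
    qed
    ultimately show "emeasure \<nu> (space \<nu>) = 1"
      by (simp add: \<nu> emeasure_density nn_integral_eq_integral g cong: nn_integral_cong)
  qed
  moreover have "measure \<nu> B \<le> 2 * measure \<mu> B" if [measurable]: "B \<in> sets \<mu>" for B
  proof -
    have "emeasure \<nu> B = (\<integral>\<^sup>+x. ennreal (g x) * indicator B x \<partial>\<mu>)"
      by (simp add: \<nu> emeasure_density)
    also have "\<dots> \<le> (\<integral>\<^sup>+x. 2 * indicator B x \<partial>\<mu>)"
      using g by (intro nn_integral_mono mult_right_mono) (auto intro: ennreal_leI[of _ 2, simplified])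
    also have "\<dots> = ennreal (2 * measure \<mu> B)"
      by (simp add: nn_integral_cmult emeasure_eq_measure ennreal_mult)
    finally show ?thesis
      by (simp add: measure_def enn2real_leI)
  qed
  ultimately show "distribution_on K \<nu>"
    by (intro distribution_on_dominated[OF \<mu>, of _ 2]) (auto simp: \<nu>)
qed

text \<open>Stationarity of the objective at \<open>\<tau>\<close> along the densities \<open>1 + t (1\<^sub>A - \<tau> A)\<close>, which are
  admissible for both signs of \<open>t\<close>, shows that the margin integrates to zero over every \<open>A\<close>.\<close>

lemma aesthetic_margin_topiary_AE_zero:
  fixes val :: "'h::{real_inner,banach} \<Rightarrow> 'a::t2_space \<Rightarrow> real"
  assumes rkhs: "rkhs val" and emb: "distributions_embed val" and K: "compact K"
    and \<psi>: "continuous_on K \<psi>" and top: "is_topiary val \<psi> K \<tau>"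
  shows "AE x in \<tau>. aesthetic_margin val \<psi> \<tau> x = 0"
proof -
  have \<tau>: "distribution_on K \<tau>"
    and max: "\<And>\<mu>. distribution_on K \<mu> \<Longrightarrow> objective val \<psi> \<mu> \<le> objective val \<psi> \<tau>"
    using top by (auto simp: is_topiary_def is_arg_max_linorder)
  interpret prob_space \<tau> using \<tau> by (simp add: distribution_on_def)
  define m where "m = embedding val \<tau>"
  define u where "u x = \<psi> x - val m x" for x
  have int_val: "integrable \<tau> (val f)" for f
    using emb K \<tau> unfolding distributions_embed_def by blast
  have int_\<psi>: "integrable \<tau> \<psi>"
    using integrable_distribution_on[OF \<tau> K \<psi>] .
  have int_u: "integrable \<tau> u"
    unfolding u_def by (intro Bochner_Integration.integrable_diff int_val int_\<psi>)
  have margin: "aesthetic_margin val \<psi> \<tau> x = u x - (\<integral>t. u t \<partial>\<tau>)" for x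
    by (simp add: aesthetic_margin_def inner_kernel[OF rkhs] u_def m_def)
  have set_int: "set_integrable \<tau> A h" if "A \<in> sets \<tau>" "integrable \<tau> h" for A and h :: "'a \<Rightarrow> real"
    unfolding set_integrable_def using integrable_mult_indicator[OF that] .
  have tilt: "(LINT x:A|\<tau>. u x) - prob A * (\<integral>x. u x \<partial>\<tau>) = 0" if A: "A \<in> sets \<tau>" for A
  proof -
    define \<nu> where "\<nu> t = density \<tau> (\<lambda>x. ennreal (1 + t * (indicator A x - prob A)))" for t
    \<comment> \<open>\<open>L h\<close> is the derivative in \<open>t\<close> of the integral of
      \<open>h\<close> against \<open>\<nu> t\<close>.\<close>
    define L where "L h = (LINT x:A|\<tau>. h x) - prob A * (\<integral>x. h x \<partial>\<tau>)" for h :: "'a \<Rightarrow> real"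
    have \<nu>: "distribution_on K (\<nu> t)" if "\<bar>t\<bar> \<le> 1" for t
      unfolding \<nu>_def by (intro distribution_on_tilt \<tau> A that)
    have int_\<nu>: "(\<integral>x. h x \<partial>\<nu> t) = (\<integral>x. h x \<partial>\<tau>) + t * L h" if "\<bar>t\<bar> \<le> 1" "integrable \<tau> h" for t h
      unfolding \<nu>_def L_def by (intro integral_tilt[OF \<tau>] A that)
    \<comment> \<open>The embedding is affine in \<open>t\<close>, so its direction can be read off
      at the admissible value \<open>t = 1\<close>; the formula then also covers negative
      \<open>t\<close>.\<close>
    define d where "d = embedding val (\<nu> 1) - m"
    have inner_m: "f \<bullet> m = (\<integral>x. val f x \<partial>\<tau>)" for f
      unfolding m_def by (rule inner_embedding[OF emb K \<tau>])
    have inner_d: "f \<bullet> d = L (val f)" for f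
      using int_\<nu>[of 1 "val f"] inner_embedding[OF emb K \<nu>[of 1], of f]
      by (simp add: d_def inner_diff_right inner_m int_val)
    have emb_\<nu>: "embedding val (\<nu> t) = m + t *\<^sub>R d" if "\<bar>t\<bar> \<le> 1" for t
      using that by (intro embedding_eqI) (simp add: int_\<nu> int_val inner_add_right inner_m inner_d)
    have "L u = L \<psi> - m \<bullet> d"
    proof -
      have "(LINT x:A|\<tau>. u x) = (LINT x:A|\<tau>. \<psi> x) - (LINT x:A|\<tau>. val m x)"
        unfolding u_def using int_\<psi> int_val A by (intro set_integral_diff set_int) auto
      thus ?thesis
        using int_\<psi> int_val[of m] by (simp add: L_def u_def inner_d algebra_simps)
    qed
    \<comment> \<open>Along \<open>m + t *\<^sub>R d\<close> the objective changes by \<open>t * (L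
      \<psi> - m \<bullet> d) - t\<^sup>2 * (norm d)\<^sup>2 / 2\<close>, which maximality makes
      nonpositive.\<close>
    moreover have "L \<psi> - m \<bullet> d = 0"
    proof (rule linear_le_quadratic_imp_zero)
      fix t :: real assume t: "\<bar>t\<bar> \<le> 1"
      show "(L \<psi> - m \<bullet> d) * t \<le> (norm d)\<^sup>2 / 2 * t\<^sup>2"
        using max[OF \<nu>[OF t]] unfolding objective_def emb_\<nu>[OF t] int_\<nu>[OF t int_\<psi>]
        unfolding m_def[symmetric] power2_norm_eq_inner
        by (simp add: inner_add inner_commute field_simps power2_eq_square)
    qed
    ultimately show ?thesis by (simp add: L_def)
  qed
  have "(LINT x:A|\<tau>. u x - (\<integral>t. u t \<partial>\<tau>)) = 0" if A: "A \<in> sets \<tau>" for A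
  proof -
    have "(LINT x:A|\<tau>. u x - (\<integral>t. u t \<partial>\<tau>)) = (LINT x:A|\<tau>. u x) - (LINT x:A|\<tau>. (\<integral>t. u t \<partial>\<tau>))"
      using int_u A by (intro set_integral_diff set_int) auto
    also have "(LINT x:A|\<tau>. (\<integral>t. u t \<partial>\<tau>)) = prob A * (\<integral>t. u t \<partial>\<tau>)"
      using A by (simp add: set_lebesgue_integral_def)
    finally show ?thesis
      using tilt[OF A] by simp
  qed
  \<comment> \<open>An integrable function whose integral over every measurable set is zero vanishes
    almost everywhere.\<close>
  hence "AE x in \<tau>. u x - (\<integral>t. u t \<partial>\<tau>) = 0"
    using int_u by (intro density_zero) auto
  thus ?thesis by (simp add: margin)
qed

section \<open>The objective as a squared distance, and the nearest-point property\<close>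

text \<open>Since \<open>\<mu>\<close> has mass 1, integrating \<open>\<psi>\<close> gives
  \<open>m \<bullet> embedding val \<mu> + c\<close>; subtracting half the squared norm of the
  embedding completes a square around \<open>m\<close>.\<close>

lemma objective_eq_dist:
  assumes emb: "distributions_embed val" and K: "compact K" and \<mu>: "distribution_on K \<mu>"
    and \<psi>: "\<And>x. x \<in> K \<Longrightarrow> \<psi> x = val m x + c"
  shows "objective val \<psi> \<mu> = c + (norm m)\<^sup>2 / 2 - (norm (embedding val \<mu> - m))\<^sup>2 / 2"
proof -
  interpret prob_space \<mu> using \<mu> by (simp add: distribution_on_def)
  have "(\<integral>x. \<psi> x \<partial>\<mu>) = (\<integral>x. val m x + c \<partial>\<mu>)"
    using space_distribution_on[OF \<mu>] by (intro Bochner_Integration.integral_cong) (auto simp: \<psi>)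
  also have "\<dots> = m \<bullet> embedding val \<mu> + c"
    using emb K \<mu> by (simp add: inner_embedding[OF emb K \<mu>] distributions_embed_def prob_space)
  finally show ?thesis
    unfolding objective_def power2_norm_eq_inner
    by (simp add: inner_diff inner_commute field_simps)
qed

theorem theorem5p1:
  fixes val :: "'h::{real_inner,banach} \<Rightarrow> 'a::t2_space \<Rightarrow> real"
    and \<psi> :: "'a \<Rightarrow> real"
    and K\<^sub>1 K\<^sub>2 :: "'a set"
    and \<tau>\<^sub>1 \<tau>\<^sub>2 :: "'a measure"
  assumes "rkhs val"
    and "distributions_embed val"
    and "continuous_on UNIV \<psi>"
    and "compact K\<^sub>1" and "K\<^sub>1 \<noteq> {}"
    and "compact K\<^sub>2" and "K\<^sub>2 \<noteq> {}"
    and "K\<^sub>1 \<subseteq> K\<^sub>2"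
    and "topiaric_index val \<psi> K\<^sub>2"
    and "is_topiary val \<psi> K\<^sub>1 \<tau>\<^sub>1"
    and "is_topiary val \<psi> K\<^sub>2 \<tau>\<^sub>2"
  shows "is_arg_min (\<lambda>\<mu>. norm (embedding val \<mu> - embedding val \<tau>\<^sub>2)) (distribution_on K\<^sub>1) \<tau>\<^sub>1"
proof -
  note emb = \<open>distributions_embed val\<close>
  obtain \<K> \<tau> where \<K>: "compact \<K>" and top: "is_topiary val \<psi> \<K> \<tau>"
    and K\<^sub>2: "K\<^sub>2 = {x\<in>\<K>. aesthetic_margin val \<psi> \<tau> x = 0}"
    using \<open>topiaric_index val \<psi> K\<^sub>2\<close> unfolding topiaric_index_def by blast
  define m where "m = embedding val \<tau>"
  \<comment> \<open>The constant subtracted in the margin of \<open>\<tau>\<close>; a vanishing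
    margin therefore reads \<open>\<psi> = m + c\<close>.\<close>
  define c where "c = (\<integral>t. (\<psi> t - val m t) \<partial>\<tau>)"
  have \<psi>: "\<psi> x = val m x + c" if "x \<in> K\<^sub>2" for x
    using that unfolding K\<^sub>2
    by (simp add: aesthetic_margin_def inner_kernel[OF \<open>rkhs val\<close>] c_def m_def)
  have obj: "objective val \<psi> \<mu> = c + (norm m)\<^sup>2 / 2 - (norm (embedding val \<mu> - m))\<^sup>2 / 2"
    if "compact K" "K \<subseteq> K\<^sub>2" "distribution_on K \<mu>" for K \<mu>
    using that \<psi> by (intro objective_eq_dist[OF emb]) auto
  have \<tau>: "distribution_on \<K> \<tau>"
    using top by (simp add: is_topiary_def is_arg_max_def)
  have "AE x in \<tau>. aesthetic_margin val \<psi> \<tau> x = 0"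
    using assms \<K> top by (intro aesthetic_margin_topiary_AE_zero) (auto intro: continuous_on_subset)
  hence full: "AE x in \<tau>. x \<in> K\<^sub>2"
    using AE_space by eventually_elim (simp add: K\<^sub>2 space_distribution_on[OF \<tau>])
  have sub: "K\<^sub>2 \<subseteq> \<K>" using K\<^sub>2 by blast
  \<comment> \<open>A distribution on \<open>K\<^sub>2\<close> must have \<open>K\<^sub>2\<close> as
    its underlying space, so \<open>\<tau>\<close> has to be restricted before it can compete with
    \<open>\<tau>\<^sub>2\<close>.\<close>
  define \<tau>' where "\<tau>' = restrict_space \<tau> K\<^sub>2"
  have \<tau>': "distribution_on K\<^sub>2 \<tau>'"
    unfolding \<tau>'_def using distribution_on_restrict_space[OF \<tau> \<open>compact K\<^sub>2\<close> sub full] .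
  have "embedding val \<tau>' = m"
  proof (rule embedding_eqI)
    fix f
    have K\<^sub>2_sets: "K\<^sub>2 \<in> sets \<tau>"
      using compact_in_sets_distribution_on[OF \<tau> \<open>compact K\<^sub>2\<close> sub] .
    have meas: "val f \<in> borel_measurable \<tau>"
      using emb \<K> \<tau> unfolding distributions_embed_def by blast
    have "(\<integral>x. val f x \<partial>\<tau>') = (LINT x:K\<^sub>2|\<tau>. val f x)"
      using K\<^sub>2_sets by (simp add: \<tau>'_def integral_restrict_space set_lebesgue_integral_def)
    also have "\<dots> = (\<integral>x. val f x \<partial>\<tau>)"
      unfolding set_lebesgue_integral_def using full K\<^sub>2_sets meas by (intro integral_cong_AE) auto
    also have "\<dots> = f \<bullet> m"
      unfolding m_def by (rule inner_embedding[OF emb \<K> \<tau>, symmetric])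
    finally show "(\<integral>x. val f x \<partial>\<tau>') = f \<bullet> m" .
  qed
  moreover have "distribution_on K\<^sub>2 \<tau>\<^sub>2" "objective val \<psi> \<tau>' \<le> objective val \<psi> \<tau>\<^sub>2"
    using \<open>is_topiary val \<psi> K\<^sub>2 \<tau>\<^sub>2\<close> \<tau>' by (auto simp: is_topiary_def is_arg_max_linorder)
  \<comment> \<open>The competitor \<open>\<tau>'\<close> has distance 0 to \<open>m\<close>, so the
    optimal \<open>\<tau>\<^sub>2\<close> cannot have positive distance.\<close>
  ultimately have "embedding val \<tau>\<^sub>2 = m"
    using obj[OF \<open>compact K\<^sub>2\<close> order_refl] \<tau>' by simp
  moreover have "norm (embedding val \<tau>\<^sub>1 - m) \<le> norm (embedding val \<mu> - m)"
    if "distribution_on K\<^sub>1 \<mu>" for \<mu>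
  proof -
    have "distribution_on K\<^sub>1 \<tau>\<^sub>1" "objective val \<psi> \<mu> \<le> objective val \<psi> \<tau>\<^sub>1"
      using \<open>is_topiary val \<psi> K\<^sub>1 \<tau>\<^sub>1\<close> that by (auto simp: is_topiary_def is_arg_max_linorder)
    hence "(norm (embedding val \<tau>\<^sub>1 - m))\<^sup>2 \<le> (norm (embedding val \<mu> - m))\<^sup>2"
      using obj[OF \<open>compact K\<^sub>1\<close> \<open>K\<^sub>1 \<subseteq> K\<^sub>2\<close>] that by simp
    thus ?thesis by (rule power2_le_imp_le) simp
  qed
  ultimately show ?thesis
    using \<open>is_topiary val \<psi> K\<^sub>1 \<tau>\<^sub>1\<close> by (auto simp: is_topiary_def is_arg_max_def is_arg_min_linorder)
qed

end
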